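(* Let $\mathcal{X}\subseteq\mathbb{R}^n$ be nonempty and compact with $\lVert x\rVert_2\le M$ for every $x\in\mathcal{X}$. Let $Q=Q_0+E$ with $Q_0=BB^{\mathsf T}\succeq0$, $B\in\mathbb{R}^{n\times r}$, and $E=E^{\mathsf T}$. For a symmetric matrix $A$ write $q_A(x)=x^{\mathsf T}Ax$. Let $\varnothing\ne\mathcal{C}\subseteq\mathcal{X}$ be a finite set containing at least one maximizer of $q_{Q_0}$ over $\mathcal{X}$, and let $\widehat x$ be a maximizer of $q_Q$ over $\mathcal{C}$. Then $$0\le\max_{x\in\mathcal{X}}q_Q(x)-q_Q(\widehat x)\le M^2\omega(E)\le2M^2\lVert E\rVert_2,$$ where $\omega(E):=\max\{\lambda_{\max}(E),0\}-\min\{\lambda_{\min}(E),0\}$. If $E\succeq0$ or $E\preceq0$, the right-hand side improves to $M^2\lVert E\rVert_2$. Writing $\operatorname{opt}_Q:=\max_{x\in\mathcal{X}}q_Q(x)$, $$v_0:=\max_{x\in\mathcal{X}}q_{Q_0}(x),\qquad U:=v_0+M^2\max\{\lambda_{\max}(E),0\},$$ one also has $$q_Q(\widehat x)\le\operatorname{opt}_Q\le U,\qquad\operatorname{opt}_Q-q_Q(\widehat x)\le U-q_Q(\widehat x).$$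
   Context: $\lVert E\rVert_2$ is the spectral norm, and $\lambda_{\max},\lambda_{\min}$ are the largest and smallest eigenvalues. *)

theory Defs
  imports "HOL-Analysis.Analysis"
begin

definition symmetric_matrix :: "real^'n^'n \<Rightarrow> bool" where
  "symmetric_matrix A \<longleftrightarrow> transpose A = A"

definition quad_form :: "real^'n^'n \<Rightarrow> real^'n \<Rightarrow> real" where
  "quad_form A x = x \<bullet> (A *v x)"

definition psd :: "real^'n^'n \<Rightarrow> bool" where
  "psd A \<longleftrightarrow> symmetric_matrix A \<and> (\<forall>x. 0 \<le> quad_form A x)"

definition nsd :: "real^'n^'n \<Rightarrow> bool" where
  "nsd A \<longleftrightarrow> symmetric_matrix A \<and> (\<forall>x. quad_form A x \<le> 0)"

definition eigenvalue :: "real^'n^'n \<Rightarrow> real \<Rightarrow> bool" where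
  "eigenvalue A k \<longleftrightarrow> (\<exists>v. v \<noteq> 0 \<and> A *v v = k *\<^sub>R v)"

(* Only real eigenvalues are considered; for a symmetric matrix these are all of
   them, and they form a finite nonempty set. *)

definition lambda_max :: "real^'n^'n \<Rightarrow> real" where
  "lambda_max A = Max {k. eigenvalue A k}"

definition lambda_min :: "real^'n^'n \<Rightarrow> real" where
  "lambda_min A = Min {k. eigenvalue A k}"

definition spectral_norm :: "real^'n^'n \<Rightarrow> real" where
  "spectral_norm A = onorm (\<lambda>x. A *v x)"

definition omega :: "real^'n^'n \<Rightarrow> real" where
  "omega A = max (lambda_max A) 0 - min (lambda_min A) 0"

(* Greatest element of the image (not merely its supremum), hence unspecified
   when the maximum is not attained. *)

definition max_over :: "('a \<Rightarrow> real) \<Rightarrow> 'a set \<Rightarrow> real" where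
  "max_over f S = (GREATEST v. v \<in> f ` S)"

lemma max_over_eq:
  assumes "x \<in> S" "\<And>y. y \<in> S \<Longrightarrow> f y \<le> f x"
  shows "max_over f S = f x"
  unfolding max_over_def using assms by (intro Greatest_equality) auto

lemma max_over_quad_form_attained:
  fixes A :: "real^'n^'n"
  assumes "compact S" "S \<noteq> {}"
  shows "\<exists>x\<in>S. quad_form A x = max_over (quad_form A) S \<and>
           is_arg_max (quad_form A) (\<lambda>x. x \<in> S) x"
proof -
  have "continuous_on S (quad_form A)"
    unfolding quad_form_def
    by (intro continuous_intros linear_continuous_on matrix_vector_mul_bounded_linear)
  then obtain x where "x \<in> S" "\<forall>y\<in>S. quad_form A y \<le> quad_form A x"
    using continuous_attains_sup assms by blast
  then show ?thesis
    using max_over_eq[of x S "quad_form A"] by (auto simp: is_arg_max_linorder)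
qed

lemma psd_mult_transpose: "psd (B ** transpose B)"
  for B :: "real^'r^'n"
proof -
  have "quad_form (B ** transpose B) x = (transpose B *v x) \<bullet> (transpose B *v x)" for x
    by (simp add: quad_form_def dot_lmul_matrix flip: matrix_vector_mul_assoc)
  then show ?thesis
    by (simp add: psd_def symmetric_matrix_def matrix_transpose_mul)
qed

end

theory Submission
  imports Defs
begin

text \<open>Writing \<open>q\<close> for quadratic forms, compare \<open>q Q = q Q0 + q E\<close> at a maximizer of \<open>q Q\<close> over
  \<open>X\<close> and at a maximizer of \<open>q Q0\<close> lying in \<open>C\<close>: the \<open>q Q0\<close> parts differ in the favourable
  direction, and the Rayleigh bounds place each \<open>q E\<close> part between \<open>M\<^sup>2 min (lambda_min E) 0\<close> and
  \<open>M\<^sup>2 max (lambda_max E) 0\<close>. The Rayleigh bounds hold because the maximum of \<open>q E\<close> on the unit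
  sphere is an eigenvalue.\<close>

lemma symmetric_matrix_inner:
  fixes A :: "real^'n^'n"
  assumes "symmetric_matrix A"
  shows "x \<bullet> (A *v y) = y \<bullet> (A *v x)"
  using assms dot_lmul_matrix[of x A y]
  by (metis symmetric_matrix_def inner_commute transpose_matrix_vector)

lemma quad_form_add: "quad_form (A + B) x = quad_form A x + quad_form B x"
  by (simp add: quad_form_def matrix_vector_mult_add_rdistrib inner_add_right)

lemma uminus_matrix_vector_mult: "(- A) *v x = - (A *v x)" for A :: "real^'n^'m"
  using matrix_vector_mult_diff_rdistrib[of 0 A x] by simp

text \<open>Eigenvectors of a symmetric matrix for distinct eigenvalues are orthogonal, so choosing
  one per eigenvalue gives an independent, hence finite, family. Finiteness makes the
  \<open>Max\<close> and \<open>Min\<close> in \<open>lambda_max\<close> and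
  \<open>lambda_min\<close> meaningful.\<close>

lemma finite_eigenvalues_symmetric:
  fixes A :: "real^'n^'n"
  assumes "symmetric_matrix A"
  shows "finite {k. eigenvalue A k}"
proof -
  let ?K = "{k. eigenvalue A k}"
  have "\<forall>k\<in>?K. \<exists>v. v \<noteq> 0 \<and> A *v v = k *\<^sub>R v"
    by (simp add: eigenvalue_def)
  then obtain f where f: "\<And>k. k \<in> ?K \<Longrightarrow> f k \<noteq> 0 \<and> A *v f k = k *\<^sub>R f k"
    by (meson bchoice)
  have orth: "f k \<bullet> f l = 0" if "k \<in> ?K" "l \<in> ?K" "k \<noteq> l" for k l
    using symmetric_matrix_inner[OF assms, of "f k" "f l"] f[OF that(1)] f[OF that(2)] that(3)
    by (auto simp: inner_commute)
  have "inj_on f ?K"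
    using orth f by (metis inj_onI inner_eq_zero_iff)
  moreover have "pairwise orthogonal (f ` ?K)"
    using orth by (auto simp: pairwise_def orthogonal_def)
  then have "independent (f ` ?K)"
    using f by (intro pairwise_orthogonal_independent) auto
  then have "finite (f ` ?K)"
    by (rule independent_imp_finite)
  ultimately show ?thesis
    by (simp add: finite_image_iff)
qed

text \<open>The witness is the maximum of the form on the unit sphere, attained by compactness; the
  first-order condition at a maximizer makes it an eigenvalue. This also shows that real eigenvalues
  exist.\<close>

lemma quad_form_le_eigenvalue:
  fixes A :: "real^'n^'n"
  assumes sym: "symmetric_matrix A"
  obtains k where "eigenvalue A k" "\<And>x. quad_form A x \<le> k * (norm x)\<^sup>2"
proof -
  obtain v where v: "norm v = 1" and max: "\<And>y. norm y = 1 \<Longrightarrow> quad_form A y \<le> quad_form A v"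
    using max_over_quad_form_attained[of "sphere 0 1 :: (real^'n) set" A]
    by (auto simp: is_arg_max_linorder)
  define k where "k = quad_form A v"
  have le: "quad_form A x \<le> k * (norm x)\<^sup>2" for x
  proof (cases "x = 0")
    case False
    have "quad_form A (x /\<^sub>R norm x) = quad_form A x / (norm x)\<^sup>2"
      by (simp add: quad_form_def matrix_vector_mult_scaleR power2_eq_square divide_inverse)
    with max[of "x /\<^sub>R norm x"] False show ?thesis
      by (simp add: k_def pos_divide_le_eq)
  qed (simp add: quad_form_def)
  define w where "w = k *\<^sub>R v - A *v v"
  define g where "g = k * (norm w)\<^sup>2 - quad_form A w"
  \<comment> \<open>Step length: the change \<open>s\<^sup>2 * g - 2 * s * (norm w)\<^sup>2\<close>
    is negative once \<open>s > 0\<close> and \<open>s * g < 2 * (norm w)\<^sup>2\<close>. This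
    choice gives \<open>s * g \<le> (norm w)\<^sup>2\<close>, and the \<open>+ 1\<close> keeps the
    denominator positive when \<open>g = 0\<close>.\<close>
  define s where "s = (norm w)\<^sup>2 / (g + 1)"
  have g0: "0 \<le> g"
    using le[of w] by (simp add: g_def)
  \<comment> \<open>The nonnegative form \<open>k (norm x)\<^sup>2 - quad_form A x\<close> vanishes at \<open>v\<close>; moving from \<open>v\<close> along
    minus its gradient would make it negative unless the gradient is zero.\<close>
  have "k * (norm (v - s *\<^sub>R w))\<^sup>2 - quad_form A (v - s *\<^sub>R w) = s\<^sup>2 * g - 2 * s * (norm w)\<^sup>2"
  proof -
    have wAv: "w \<bullet> (A *v v) = k * (w \<bullet> v) - w \<bullet> w"
      by (simp add: w_def inner_diff_right)
    have vv: "v \<bullet> (A *v v) = k" "v \<bullet> v = 1"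
      using v by (simp_all add: k_def quad_form_def dot_square_norm)
    have vAw: "v \<bullet> (A *v w) = w \<bullet> (A *v v)"
      by (rule symmetric_matrix_inner[OF sym])
    show ?thesis
      unfolding g_def quad_form_def power2_norm_eq_inner matrix_vector_mult_diff_distrib
        matrix_vector_mult_scaleR inner_diff_left inner_diff_right inner_scaleR_left
        inner_scaleR_right inner_commute[of v w] vAw wAv vv
      by (simp add: power2_eq_square algebra_simps)
  qed
  then have step: "s * (2 * (norm w)\<^sup>2) \<le> s * (s * g)"
    using le[of "v - s *\<^sub>R w"] by (simp add: power2_eq_square algebra_simps)
  have sg: "s * g \<le> (norm w)\<^sup>2"
    using g0 by (simp add: s_def field_simps)
  have "w = 0"
  proof (rule ccontr)
    assume "w \<noteq> 0"
    then have pos: "0 < (norm w)\<^sup>2"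
      by simp
    with g0 have "0 < s"
      by (simp add: s_def)
    with step have "2 * (norm w)\<^sup>2 \<le> s * g"
      by (rule mult_left_le_imp_le)
    with sg pos show False
      by linarith
  qed
  then have "eigenvalue A k"
    using v unfolding eigenvalue_def w_def by (metis eq_iff_diff_eq_0 norm_zero zero_neq_one)
  then show thesis
    using le that by blast
qed

lemma eigenvalue_uminus_iff: "eigenvalue (- A) k \<longleftrightarrow> eigenvalue A (- k)"
  unfolding eigenvalue_def
  by (metis neg_equal_iff_equal add.inverse_inverse scaleR_minus_left uminus_matrix_vector_mult)

text \<open>Apply the upper bound to \<open>- A\<close>, whose eigenvalues are the negatives of
  those of \<open>A\<close>.\<close>

lemma quad_form_ge_eigenvalue:
  fixes A :: "real^'n^'n"
  assumes "symmetric_matrix A"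
  obtains k where "eigenvalue A k" "\<And>x. k * (norm x)\<^sup>2 \<le> quad_form A x"
proof -
  have "symmetric_matrix (- A)"
    using assms by (simp add: symmetric_matrix_def transpose_def vec_eq_iff)
  then obtain k where "eigenvalue (- A) k" "\<And>x. quad_form (- A) x \<le> k * (norm x)\<^sup>2"
    using quad_form_le_eigenvalue by blast
  then have "eigenvalue A (- k)" "\<And>x. - k * (norm x)\<^sup>2 \<le> quad_form A x"
    by (simp_all add: eigenvalue_uminus_iff quad_form_def uminus_matrix_vector_mult minus_le_iff)
  then show thesis
    by (rule that)
qed

context
  fixes A :: "real^'n^'n"
  assumes sym: "symmetric_matrix A"
begin

text \<open>The spectrum is finite by orthogonality and nonempty by the sphere argument, so its
  \<open>Max\<close> belongs to it.\<close>

lemma eigenvalue_lambda_max: "eigenvalue A (lambda_max A)"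
  using Max_in[OF finite_eigenvalues_symmetric[OF sym]] quad_form_le_eigenvalue[OF sym]
  unfolding lambda_max_def by blast

lemma eigenvalue_lambda_min: "eigenvalue A (lambda_min A)"
  using Min_in[OF finite_eigenvalues_symmetric[OF sym]] quad_form_le_eigenvalue[OF sym]
  unfolding lambda_min_def by blast

lemma quad_form_le_lambda_max: "quad_form A x \<le> lambda_max A * (norm x)\<^sup>2"
proof -
  obtain k where k: "eigenvalue A k" "quad_form A x \<le> k * (norm x)\<^sup>2"
    using quad_form_le_eigenvalue[OF sym] by blast
  then have "k \<le> lambda_max A"
    unfolding lambda_max_def by (simp add: finite_eigenvalues_symmetric[OF sym])
  then show ?thesis
    using k(2) by (meson mult_right_mono order_trans zero_le_power2)
qed

lemma lambda_min_le_quad_form: "lambda_min A * (norm x)\<^sup>2 \<le> quad_form A x"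
proof -
  obtain k where k: "eigenvalue A k" "k * (norm x)\<^sup>2 \<le> quad_form A x"
    using quad_form_ge_eigenvalue[OF sym] by blast
  then have "lambda_min A \<le> k"
    unfolding lambda_min_def by (simp add: finite_eigenvalues_symmetric[OF sym])
  then show ?thesis
    using k(2) by (meson mult_right_mono order_trans zero_le_power2)
qed

end

lemma abs_eigenvalue_le_spectral_norm:
  fixes A :: "real^'n^'n"
  assumes "eigenvalue A k"
  shows "\<bar>k\<bar> \<le> spectral_norm A"
proof -
  obtain v where v: "v \<noteq> 0" "A *v v = k *\<^sub>R v"
    using assms by (auto simp: eigenvalue_def)
  have "norm (A *v v) \<le> spectral_norm A * norm v"
    unfolding spectral_norm_def by (rule onorm[OF matrix_vector_mul_bounded_linear])
  then show ?thesis
    using v by simp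
qed

text \<open>Ties the sign of an eigenvalue to that of the form at an eigenvector, so that
  semidefiniteness fixes the signs of the spectrum.\<close>

lemma eigenvalue_quad_form:
  fixes A :: "real^'n^'n"
  assumes "eigenvalue A k"
  obtains v where "v \<noteq> 0" "quad_form A v = k * (norm v)\<^sup>2"
  using assms by (auto simp: eigenvalue_def quad_form_def power2_norm_eq_inner)

lemma psd_eigenvalue_nonneg: "psd A \<Longrightarrow> eigenvalue A k \<Longrightarrow> 0 \<le> k"
  by (erule eigenvalue_quad_form)
    (metis psd_def zero_le_mult_iff zero_less_norm_iff zero_less_power not_le)

lemma nsd_eigenvalue_nonpos: "nsd A \<Longrightarrow> eigenvalue A k \<Longrightarrow> k \<le> 0"
  by (erule eigenvalue_quad_form)
    (metis nsd_def mult_le_0_iff zero_less_norm_iff zero_less_power not_le)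

theorem theorem7p1:
  fixes X C :: "(real^'n) set" and M :: real
    and Q Q0 E :: "real^'n^'n" and B :: "real^'r^'n"
    and xhat :: "real^'n" and opt v0 U :: real
  assumes "X \<noteq> {}" and "compact X" and "\<And>x. x \<in> X \<Longrightarrow> norm x \<le> M"
    and "Q = Q0 + E" and "Q0 = B ** transpose B" and "symmetric_matrix E"
    and "C \<noteq> {}" and "C \<subseteq> X" and "finite C"
    and "\<exists>x\<in>C. is_arg_max (quad_form Q0) (\<lambda>x. x \<in> X) x"
    and "is_arg_max (quad_form Q) (\<lambda>x. x \<in> C) xhat"
    and "opt = max_over (quad_form Q) X"
    and "v0 = max_over (quad_form Q0) X"
    and "U = v0 + M\<^sup>2 * max (lambda_max E) 0"
  shows "(0 \<le> opt - quad_form Q xhat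
          \<and> opt - quad_form Q xhat \<le> M\<^sup>2 * omega E
          \<and> M\<^sup>2 * omega E \<le> 2 * M\<^sup>2 * spectral_norm E)
       \<and> (psd E \<or> nsd E \<longrightarrow> M\<^sup>2 * omega E \<le> M\<^sup>2 * spectral_norm E)
       \<and> (quad_form Q xhat \<le> opt \<and> opt \<le> U)
       \<and> opt - quad_form Q xhat \<le> U - quad_form Q xhat"
proof -
  note sym = \<open>symmetric_matrix E\<close>
  obtain xs where xs: "xs \<in> X" "quad_form Q xs = opt" "\<And>y. y \<in> X \<Longrightarrow> quad_form Q y \<le> opt"
    using max_over_quad_form_attained[OF assms(2,1), of Q] assms(12)
    by (auto simp: is_arg_max_linorder)
  obtain x0 where x0: "x0 \<in> C" and x0_max: "\<And>y. y \<in> X \<Longrightarrow> quad_form Q0 y \<le> quad_form Q0 x0"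
    using assms(10) by (auto simp: is_arg_max_linorder)
  have v0: "v0 = quad_form Q0 x0"
    using max_over_eq[of x0 X "quad_form Q0"] x0 x0_max assms(8,13) by auto
  have xhat: "xhat \<in> X" "quad_form Q x0 \<le> quad_form Q xhat"
    using assms(8,11) x0 by (auto simp: is_arg_max_linorder)
  have Q: "quad_form Q x = quad_form Q0 x + quad_form E x" for x
    by (simp add: assms(4) quad_form_add)
  have sq: "(norm x)\<^sup>2 \<le> M\<^sup>2" if "x \<in> X" for x
    using assms(3)[OF that] by (simp add: power_mono)
  \<comment> \<open>Clipping at 0 makes the coefficient nonnegative, so
    \<open>(norm x)\<^sup>2\<close> may be enlarged to \<open>M\<^sup>2\<close>; a negative
    \<open>lambda_max E\<close> would reverse that step. The clipped minimum in \<open>lower\<close>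
    serves the same purpose.\<close>
  have upper: "quad_form E x \<le> M\<^sup>2 * max (lambda_max E) 0" if "x \<in> X" for x
  proof -
    have "quad_form E x \<le> max (lambda_max E) 0 * (norm x)\<^sup>2"
      by (rule order_trans[OF quad_form_le_lambda_max[OF sym]]) (simp add: mult_right_mono)
    also have "\<dots> \<le> max (lambda_max E) 0 * M\<^sup>2"
      by (simp add: mult_left_mono sq that)
    finally show ?thesis by (simp add: mult.commute)
  qed
  have lower: "M\<^sup>2 * min (lambda_min E) 0 \<le> quad_form E x" if "x \<in> X" for x
  proof -
    have "min (lambda_min E) 0 * M\<^sup>2 \<le> min (lambda_min E) 0 * (norm x)\<^sup>2"
      by (simp add: mult_left_mono_neg sq that)
    also have "\<dots> \<le> quad_form E x"
      by (rule order_trans[OF _ lambda_min_le_quad_form[OF sym]]) (simp add: mult_right_mono)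
    finally show ?thesis by (simp add: mult.commute)
  qed
  have opt_le: "opt \<le> U"
    using upper[OF xs(1)] x0_max[OF xs(1)] xs(2) Q[of xs] v0 assms(14) by simp
  \<comment> \<open>\<open>xhat\<close> does at least as well as the candidate \<open>x0\<close> for
    \<open>Q\<close>, and at \<open>x0\<close> the \<open>Q0\<close> part is exactly
    \<open>v0\<close>.\<close>
  moreover have "v0 + M\<^sup>2 * min (lambda_min E) 0 \<le> quad_form Q xhat"
    using lower[of x0] x0 assms(8) xhat(2) Q[of x0] v0 by auto
  ultimately have gap: "opt - quad_form Q xhat \<le> M\<^sup>2 * omega E"
    using assms(14) by (simp add: omega_def algebra_simps)
  note eig = eigenvalue_lambda_max[OF sym] eigenvalue_lambda_min[OF sym]
  note bounds = eig[THEN abs_eigenvalue_le_spectral_norm]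
  have "omega E \<le> 2 * spectral_norm E"
    using bounds by (auto simp: omega_def)
  then have "M\<^sup>2 * omega E \<le> 2 * M\<^sup>2 * spectral_norm E"
    using mult_left_mono[of "omega E" "2 * spectral_norm E" "M\<^sup>2"] by (simp add: mult_ac)
  \<comment> \<open>Semidefiniteness makes one of the two clipped terms of \<open>omega E\<close>
    vanish, and the other is at most the norm.\<close>
  moreover have "omega E \<le> spectral_norm E" if "psd E \<or> nsd E"
    using that bounds eig[THEN psd_eigenvalue_nonneg[rotated]]
      eig[THEN nsd_eigenvalue_nonpos[rotated]]
    by (auto simp: omega_def)
  ultimately show ?thesis
    using xs(3)[OF xhat(1)] gap opt_le by (auto intro: mult_left_mono)
qed

end
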